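(* Let $X$ be a log-concave real random variable with $\mathbb{E}X=0$. Then for all real $p \geq q \geq 1$ one has $\|X\|_p \leq \frac{p}{q}\,\|X\|_q$.
   Context: A real random variable $X$ is called log-concave if either $X$ is constant almost surely, or $X$ has a density (with respect to Lebesgue measure) of the form $e^{-V}$ with $V:\mathbb{R}\to\mathbb{R}\cup\{+\infty\}$ convex. For $s>0$, $\|X\|_s=(\mathbb{E}|X|^s)^{1/s}$. *)

theory Defs
  imports "HOL-Probability.Probability"
begin

text \<open>
  Convexity of \<open>V : \<real> \<rightarrow> \<real> \<union> {+\<infinity>}\<close>. The value \<open>-\<infinity>\<close> is excluded explicitly because
  \<^typ>\<open>ereal\<close> contains it. In \<^typ>\<open>ereal\<close>, \<open>0 * \<infinity> = 0\<close>, so the inequality is trivially true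
  for \<open>u = 0\<close> or \<open>v = 0\<close>.
\<close>
definition convex_ext :: "(real \<Rightarrow> ereal) \<Rightarrow> bool" where
  "convex_ext V \<longleftrightarrow>
     (\<forall>x. V x \<noteq> -\<infinity>) \<and>
     (\<forall>x y u v. 0 \<le> u \<longrightarrow> 0 \<le> v \<longrightarrow> u + v = 1 \<longrightarrow>
        V (u * x + v * y) \<le> ereal u * V x + ereal v * V y)"

text \<open>\<open>e\<^sup>-\<^sup>v\<close> for \<open>v \<in> \<real> \<union> {+\<infinity>}\<close>; the value at \<open>-\<infinity>\<close> is never used.\<close>
definition exp_neg :: "ereal \<Rightarrow> ennreal" where
  "exp_neg v = (if v = \<infinity> then 0 else ennreal (exp (- real_of_ereal v)))"

definition log_concave :: "'a measure \<Rightarrow> ('a \<Rightarrow> real) \<Rightarrow> bool" where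
  "log_concave M X \<longleftrightarrow>
     (\<exists>c. AE \<omega> in M. X \<omega> = c) \<or>
     (\<exists>V. convex_ext V \<and> distributed M lborel X (\<lambda>x. exp_neg (V x)))"

text \<open>
  \<open>\<parallel>X\<parallel>\<^sub>s = (E |X|\<^sup>s)\<^sup>1\<^sup>/\<^sup>s\<close> for \<open>s > 0\<close>, with values in \<open>[0,\<infinity>]\<close>: the expectation is the
  nonnegative Lebesgue integral, so a divergent moment gives \<open>\<infinity>\<close> and not the default value \<open>0\<close>
  of the Bochner integral.
\<close>
definition moment_norm :: "'a measure \<Rightarrow> real \<Rightarrow> ('a \<Rightarrow> real) \<Rightarrow> ennreal" where
  "moment_norm M s X =
     (let m = (\<integral>\<^sup>+ \<omega>. ennreal (\<bar>X \<omega>\<bar> powr s) \<partial>M)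
      in if m = \<infinity> then \<infinity> else ennreal (enn2real m powr (1 / s)))"

end

theory Submission
  imports Defs
begin

text \<open>
  Split \<open>X\<close> into \<open>X\<^sub>+\<close> and \<open>X\<^sub>-\<close>, with \<open>w\<^sub>+ = P (X \<ge> 0)\<close> and \<open>w\<^sub>- = P (X \<le> 0)\<close>. The tail of \<open>X\<close> is
  log-concave, so it crosses an exponential \<open>w\<^sub>+ exp (- t / \<mu>)\<close> with the same \<open>q\<close>-th moment only once, which
  bounds \<open>E X\<^sub>+\<^sup>p\<close> by its exponential counterpart; likewise for \<open>X\<^sub>-\<close>. Gruenbaum's inequality gives
  \<open>w\<^sub>+, w\<^sub>- \<ge> 1 / e\<close>. Since \<open>E X\<^sub>+ = E X\<^sub>-\<close>, Jensen's inequality from below and the case \<open>q = 1\<close> of the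
  comparison from above keep the ratio of \<open>E X\<^sub>+\<^sup>q\<close> and \<open>E X\<^sub>-\<^sup>q\<close> bounded, so that neither side carries more
  than a fixed multiple \<open>D w\<^sub>\<plusminus>\<close> of \<open>E \<bar>X\<bar>\<^sup>q\<close>. Adding both sides leaves the numerical inequality
  \<open>\<Gamma>(p + 1) D\<^bsup>p/q - 1\<^esup> \<le> (p / q)\<^sup>p \<Gamma>(q + 1)\<^bsup>p/q\<^esup>\<close>. Its logarithm is an equality at \<open>p = q\<close>, and the difference
  of the two sides is convex in \<open>p\<close>, so only the slope at \<open>p = q\<close> matters.
\<close>

subsection \<open>Gamma function estimates\<close>

text \<open>Each term of the series of \<open>1 / t^2\<close> over \<open>t = x + k\<close> is at
  most \<open>1 / ((t - 1/2) * (t + 1/2))\<close>, and these majorants telescope.\<close>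

lemma Trigamma_real_le:
  fixes x :: real
  assumes "x > 1/2"
  shows "Polygamma 1 x \<le> 1 / (x - 1/2)"
proof -
  have "(\<lambda>k. inverse ((x + real k)^2)) sums Polygamma 1 x"
    using Polygamma_LIMSEQ[of x 1] assms by (simp add: numeral_2_eq_2)
  moreover have "(\<lambda>k. 1 / (x - 1/2 + real k) - 1 / (x - 1/2 + real (Suc k))) sums (1 / (x - 1/2 + real 0) - 0)"
  proof (rule telescope_sums')
    show "(\<lambda>k. 1 / (x - 1/2 + real k)) \<longlonglongrightarrow> 0"
      by real_asymp
  qed
  moreover have "inverse ((x + real k)^2) \<le> 1 / (x - 1/2 + real k) - 1 / (x - 1/2 + real (Suc k))" for k
  proof -
    define t where "t = x + real k"
    have t: "t > 1/2" using assms by (simp add: t_def)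
    have "1 / a - 1 / (a + 1) = 1 / (a * (a + 1))" if "a > 0" for a :: real
      using that by (simp add: field_simps)
    from this[of "t - 1/2"] have "1 / (t - 1/2) - 1 / (t + 1/2) = 1 / ((t - 1/2) * (t + 1/2))"
      using t by (simp add: add.commute)
    moreover have "inverse (t^2) \<le> 1 / ((t - 1/2) * (t + 1/2))"
    proof -
      have "(t - 1/2) * (t + 1/2) \<le> t^2" "(t - 1/2) * (t + 1/2) > 0"
        using t by (simp add: power2_eq_square algebra_simps, intro mult_pos_pos) auto
      then show ?thesis
        by (metis inverse_eq_divide le_imp_inverse_le)
    qed
    ultimately show ?thesis by (simp add: t_def algebra_simps)
  qed
  ultimately show ?thesis
    using sums_le[of "\<lambda>k. inverse ((x + real k)^2)"] by force
qed

text \<open>The derivative \<open>1 / t - Polygamma 1 (t + 1)\<close> is nonnegative by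
  \<open>Trigamma_real_le\<close>. This is the convexity in \<open>p\<close> behind
  \<open>Gamma_share_bound\<close>.\<close>

lemma ln_minus_Digamma_mono:
  fixes x y :: real
  assumes "0 < x" "x \<le> y"
  shows "ln x - Digamma (x + 1) \<le> ln y - Digamma (y + 1)"
proof (rule DERIV_nonneg_imp_nondecreasing[OF assms(2)], intro exI conjI)
  fix t assume t: "x \<le> t" "t \<le> y"
  show "((\<lambda>t. ln t - Digamma (t + 1)) has_field_derivative (1 / t - Polygamma 1 (t + 1))) (at t)"
    using t assms by (auto intro!: derivative_eq_intros)
  have "1 / (t + 1/2) \<le> 1 / t" using t assms by (simp add: field_simps)
  then show "0 \<le> 1 / t - Polygamma 1 (t + 1)"
    using Trigamma_real_le[of "t + 1"] t assms by (simp add: algebra_simps)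
qed

text \<open>By \<open>Trigamma_real_le\<close> the right-hand side has derivative at least
  \<open>1 / (2 * q + 1)\<close>, which is the derivative of the logarithmic term on the left. At
  \<open>q = 1\<close> the right-hand side is the Euler-Mascheroni constant.\<close>

lemma ln_Gamma_minus_Digamma_ge:
  fixes q :: real
  assumes "1 \<le> q"
  shows "19/33 + ln ((2 * q + 1) / 3) / 2 \<le> q + ln_Gamma (q + 1) - q * Digamma (q + 1)"
proof -
  define h where "h = (\<lambda>t::real. t + ln_Gamma (t + 1) - t * Digamma (t + 1) - ln ((2 * t + 1) / 3) / 2)"
  have "h 1 \<le> h q"
  proof (rule DERIV_nonneg_imp_nondecreasing[OF assms], intro exI conjI)
    fix t :: real assume t: "1 \<le> t" "t \<le> q"
    show "(h has_field_derivative (1 - t * Polygamma 1 (t + 1) - 1 / (2 * t + 1))) (at t)"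
      unfolding h_def using t by (auto intro!: derivative_eq_intros simp: field_simps)
    have "Polygamma 1 (t + 1) \<le> 1 / (t + 1/2)"
      using Trigamma_real_le[of "t + 1"] t by (simp add: algebra_simps)
    then have "t * Polygamma 1 (t + 1) \<le> t * (1 / (t + 1/2))"
      using t by (intro mult_left_mono) auto
    moreover have "t * (1 / (t + 1/2)) + 1 / (2 * t + 1) = 1"
      using t by (simp add: field_simps)
    ultimately show "0 \<le> 1 - t * Polygamma 1 (t + 1) - 1 / (2 * t + 1)" by linarith
  qed
  moreover have "h 1 = euler_mascheroni"
  proof -
    have "Digamma (2::real) = 1 - euler_mascheroni"
      using Digamma_plus1[of "1::real"] by simp
    moreover have "ln_Gamma (2::real) = 0" by (simp add: ln_Gamma_real_pos Gamma_numeral)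
    ultimately show ?thesis by (simp add: h_def)
  qed
  ultimately show ?thesis using euler_mascheroni_gt_19_over_33 by (simp add: h_def)
qed

text \<open>The exponent is \<open>2 (1 - 19/33)\<close>, where \<open>19/33\<close> is a lower bound for the Euler-Mascheroni constant.\<close>
lemma exp_28_33: "exp (28/33 :: real) \<le> 117/50"
proof -
  have "exp (28/33::real) * exp (5/33) = exp 1" by (simp flip: exp_add)
  moreover have "1 + 5/33 + (5/33)\<^sup>2 / 2 \<le> exp (5/33::real)"
    by (rule exp_lower_Taylor_quadratic) simp
  ultimately have "exp (28/33::real) * (1 + 5/33 + (5/33)\<^sup>2 / 2) \<le> 272/100"
    using e_less_272 mult_left_mono[of "1 + 5/33 + (5/33)\<^sup>2 / 2" "exp (5/33::real)" "exp (28/33)"] by (smt (verit) exp_ge_zero)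
  moreover have "(117/50) * (1 + 5/33 + (5/33)\<^sup>2 / 2) \<ge> (272/100::real)"
    by (simp add: power2_eq_square)
  ultimately have "exp (28/33::real) * (1 + 5/33 + (5/33)\<^sup>2 / 2) \<le> (117/50) * (1 + 5/33 + (5/33)\<^sup>2 / 2)"
    by linarith
  then show ?thesis by (rule mult_right_le_imp_le) (simp add: add_pos_nonneg)
qed

text \<open>The bound on \<open>E X\<^sub>+\<^sup>q / E X\<^sub>-\<^sup>q\<close> for a mean-zero \<open>X\<close> in the extreme case \<open>P (X \<ge> 0) = 1 / e\<close>.\<close>
definition imbalance :: "real \<Rightarrow> real" where
  "imbalance q = Gamma (q + 1) * (exp 1 - 1) powr (q - 1)"

lemma exp1_gt_2: "exp (1::real) > 2"
  using exp_lower_Taylor_quadratic[of 1] by simp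

lemma imbalance_pos: "q \<ge> 1 \<Longrightarrow> imbalance q > 0"
  using exp1_gt_2 by (auto simp: imbalance_def intro!: mult_pos_pos Gamma_real_pos)

text \<open>\<open>imbalance\<close> is log-convex because \<open>Gamma\<close> is, hence convex.
  Bounds at integers therefore extend to the intervals between them.\<close>

lemma imbalance_chord:
  fixes u :: real
  assumes "1 \<le> a" "0 \<le> u" "u \<le> 1"
  shows "imbalance (a + u) \<le> (1 - u) * imbalance a + u * imbalance (a + 1)"
proof -
  define g where "g = (\<lambda>q::real. ln (Gamma (q + 1)) + (q - 1) * ln (exp 1 - 1))"
  have tg: "imbalance q = exp (g q)" if "q \<ge> 1" for q
    using that exp1_gt_2 Gamma_real_pos[of "q+1"] by (simp add: imbalance_def g_def exp_add powr_def)
  have "ln (Gamma ((1 - u) * (a + 1) + u * (a + 2))) \<le> (1 - u) * ln (Gamma (a + 1)) + u * ln (Gamma (a + 2))"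
    using convex_onD[OF log_convex_Gamma_real, of u "a + 1" "a + 2"] assms by simp
  moreover have "(1 - u) * (a + 1) + u * (a + 2) = a + u + 1" by (simp add: algebra_simps)
  ultimately have "ln (Gamma (a + u + 1)) \<le> (1 - u) * ln (Gamma (a + 1)) + u * ln (Gamma (a + 2))"
    by simp
  then have "g (a + u) \<le> (1 - u) * g a + u * g (a + 1)"
    by (simp add: g_def algebra_simps)
  then have "exp (g (a + u)) \<le> exp ((1 - u) * g a + u * g (a + 1))" by simp
  also have "\<dots> \<le> (1 - u) * exp (g a) + u * exp (g (a + 1))"
    using convex_onD[OF exp_convex, of u "g a" "g (a + 1)"] assms by simp
  finally show ?thesis using assms tg[of "a+u"] tg[of a] tg[of "a+1"] by simp
qed

text \<open>The bounds at integers come from \<open>exp 1 - 1 <= 1.72\<close>; they are the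
  endpoints of the chords in \<open>imbalance_bound\<close>.\<close>

lemma imbalance_values: "imbalance 1 = 1" "imbalance 2 \<le> 344/100" "imbalance 3 \<le> 1776/100" "imbalance 4 \<le> 123"
proof -
  have e: "exp (1::real) - 1 \<le> 172/100" "exp (1::real) - 1 > 1" using e_less_272 exp1_gt_2 by auto
  show "imbalance 1 = 1" using e by (simp add: imbalance_def Gamma_numeral)
  show "imbalance 2 \<le> 344/100" using e by (simp add: imbalance_def Gamma_numeral)
  have "(exp (1::real) - 1)^2 \<le> (172/100)^2" using e by (intro power_mono) auto
  then show "imbalance 3 \<le> 1776/100" using e 
    by (simp add: imbalance_def Gamma_numeral powr_numeral fact_numeral power2_eq_square)
  have "(exp (1::real) - 1)^3 \<le> (172/100)^3" using e by (intro power_mono) auto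
  then show "imbalance 4 \<le> 123" using e 
    by (simp add: imbalance_def Gamma_numeral powr_numeral fact_numeral eval_nat_numeral)
qed

text \<open>The constant is \<open>3 \<cdot> 117/50\<close>, which bounds \<open>3 exp (28/33)\<close>.\<close>
lemma imbalance_bound:
  assumes "q \<ge> 1"
  shows "702/100 \<le> (1 + 1 / imbalance q)^2 * (2 * q + 1)"
proof -
  have pos: "imbalance q > 0" by (rule imbalance_pos[OF assms])
  \<comment> \<open>The expression decreases in \<open>imbalance q\<close>, so an upper bound
    \<open>y\<close> may replace it; clearing denominators leaves a polynomial inequality.\<close>
  have red: ?thesis if "imbalance q \<le> y" "702/100 * y^2 \<le> (y + 1)^2 * (2 * q + 1)" for y
  proof -
    have y: "y > 0" using that pos by linarith
    have "702/100 \<le> (1 + 1 / y)^2 * (2 * q + 1)"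
      using that(2) y by (simp add: field_simps power2_eq_square)
    also have "\<dots> \<le> (1 + 1 / imbalance q)^2 * (2 * q + 1)"
      using that(1) pos y assms by (intro mult_right_mono power_mono) (auto simp: field_simps)
    finally show ?thesis .
  qed
  consider "q \<le> 2" | "2 \<le> q" "q \<le> 3" | "3 \<le> q" "q \<le> 4" | "4 \<le> q" using assms by linarith
  then show ?thesis
  proof cases
    case 1
    define u where "u = q - 1"
    have u: "0 \<le> u" "u \<le> 1" "q = 1 + u" using 1 assms by (auto simp: u_def)
    have "imbalance q \<le> (1 - u) * 1 + u * imbalance 2" using imbalance_chord[of 1 u] imbalance_values u by simp
    also have "\<dots> \<le> (1 - u) * 1 + u * (344/100)" using imbalance_values u by (intro add_mono mult_left_mono) auto
    also have "\<dots> = 1 + 244/100 * u" by (simp add: field_simps)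
    finally have *: "imbalance q \<le> 1 + 244/100 * u" .
    show ?thesis
    proof (rule red[OF *])
      have "0 \<le> u^3" "u^2 \<le> 1" using u by (auto intro: power_le_one)
      moreover have "(1 + 244/100 * u + 1)^2 * (2 * q + 1) - 702/100 * (1 + 244/100 * u)^2
          = 498/100 + 30224/10000 * u - 4413472/1000000 * u^2 + 119072/10000 * u^3"
        by (simp add: u field_simps power2_eq_square power3_eq_cube)
      ultimately show "702/100 * (1 + 244/100 * u)^2 \<le> (1 + 244/100 * u + 1)^2 * (2 * q + 1)"
        using u(1) by linarith
    qed
  next
    case 2
    define u where "u = q - 2"
    have u: "0 \<le> u" "u \<le> 1" "q = 2 + u" using 2 by (auto simp: u_def)
    have "imbalance q \<le> (1 - u) * imbalance 2 + u * imbalance 3" using imbalance_chord[of 2 u] u by simp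
    also have "\<dots> \<le> (1 - u) * (344/100) + u * (1776/100)" using imbalance_values u by (intro add_mono mult_left_mono) auto
    also have "\<dots> = 344/100 + 1432/100 * u" by (simp add: field_simps)
    finally have *: "imbalance q \<le> 344/100 + 1432/100 * u" .
    show ?thesis
    proof (rule red[OF *])
      \<comment> \<open>The cubic below has its minimum near \<open>u = 3/10\<close>. Subtracting a
        multiple of the first expression leaves a quadratic with minimum near \<open>31/100\<close>,
        which the second one handles.\<close>
      have "0 \<le> u * (u - 3/10)^2" "0 \<le> (u - 31/100)^2" using u by auto
      moreover have "u * (u - 3/10)^2 = u^3 - 6/10 * u^2 + 9/100 * u" "(u - 31/100)^2 = u^2 - 62/100 * u + 961/10000"
        by (simp_all add: field_simps power2_eq_square power3_eq_cube)
      moreover have "(344/100 + 1432/100 * u + 1)^2 * (2 * q + 1) - 702/100 * (344/100 + 1432/100 * u)^2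
          = 15496128/1000000 - 16386432/1000000 * u - 159902848/1000000 * u^2 + 4101248/10000 * u^3"
        by (simp add: u field_simps power2_eq_square power3_eq_cube)
      ultimately show "702/100 * (344/100 + 1432/100 * u)^2 \<le> (344/100 + 1432/100 * u + 1)^2 * (2 * q + 1)"
        using u(1) by linarith
    qed
  next
    case 3
    define u where "u = q - 3"
    have u: "0 \<le> u" "u \<le> 1" "q = 3 + u" using 3 by (auto simp: u_def)
    have "imbalance q \<le> (1 - u) * imbalance 3 + u * imbalance 4" using imbalance_chord[of 3 u] u by simp
    \<comment> \<open>Here \<open>2 * q + 1 >= 7\<close> is almost \<open>7.02\<close> already, so a
      crude constant bound suffices.\<close>
    also have "\<dots> \<le> (1 - u) * 123 + u * 123" using imbalance_values u by (intro add_mono mult_left_mono) auto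
    finally have *: "imbalance q \<le> 123" by simp
    show ?thesis by (rule red[OF *]) (use 3 in \<open>simp add: power2_eq_square\<close>)
  next
    case 4
    have "1 * (702/100) \<le> (1 + 1 / imbalance q)^2 * (2 * q + 1)"
      using 4 pos by (intro mult_mono) auto
    then show ?thesis by simp
  qed
qed

section \<open>The constant of the two-sided argument and the numerical inequality\<close>

text \<open>The \<open>D\<close> of the plan at the beginning:
  \<open>1 / (1 + 1 / imbalance q)\<close> bounds the fraction of the \<open>q\<close>-th moment
  lying on one side, and \<open>exp 1\<close> times the probability of that side is at least
  \<open>1\<close>.\<close>

definition share_bound :: "real \<Rightarrow> real" where
  "share_bound q = exp 1 / (1 + 1 / imbalance q)"

lemma share_bound_pos: "q \<ge> 1 \<Longrightarrow> share_bound q > 0"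
  using imbalance_pos[of q] by (auto simp: share_bound_def intro!: divide_pos_pos add_pos_pos)

text \<open>This is the slope condition at \<open>p = q\<close> for
  \<open>Gamma_share_bound\<close>. Taking logarithms in \<open>imbalance_bound\<close> and halving
  leaves \<open>1 - 14/33 = 19/33\<close>.\<close>

lemma ln_share_bound_le:
  assumes "q \<ge> 1"
  shows "ln (share_bound q) \<le> q + ln_Gamma (q + 1) - q * Digamma (q + 1)"
proof -
  have pos: "1 + 1 / imbalance q > 0" using imbalance_pos[OF assms] by (auto intro!: add_pos_pos)
  have "exp (28/33) \<le> (1 + 1 / imbalance q)^2 * ((2 * q + 1) / 3)"
    using imbalance_bound[OF assms] exp_28_33 by simp
  then have "28/33 \<le> ln ((1 + 1 / imbalance q)^2 * ((2 * q + 1) / 3))"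
    using pos assms by (subst ln_ge_iff) auto
  also have "\<dots> = 2 * ln (1 + 1 / imbalance q) + ln ((2 * q + 1) / 3)"
    using pos assms by (subst ln_mult) (auto simp: ln_realpow)
  finally have "1 - ln (1 + 1 / imbalance q) \<le> 19/33 + ln ((2 * q + 1) / 3) / 2" by simp
  also have "1 - ln (1 + 1 / imbalance q) = ln (share_bound q)"
    using pos by (simp add: share_bound_def ln_div)
  finally show ?thesis using ln_Gamma_minus_Digamma_ge[OF assms] by linarith
qed

lemma Gamma_share_bound:
  fixes p q :: real
  assumes "1 \<le> q" "q \<le> p"
  shows "Gamma (p + 1) * share_bound q powr (p / q - 1) \<le> (p / q) powr p * Gamma (q + 1) powr (p / q)"
proof -
  define d where "d = ln (share_bound q)"
  \<comment> \<open>The logarithm of the right-hand side minus that of the left-hand side at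
    \<open>p = t\<close>. Its derivative increases in \<open>t\<close> and is nonnegative at
    \<open>t = q\<close>.\<close>
  define h where "h = (\<lambda>t. t * (ln t - ln q) + t / q * ln_Gamma (q + 1) - ln_Gamma (t + 1) - (t / q - 1) * d)"
  have "h q \<le> h p"
  proof (rule DERIV_nonneg_imp_nondecreasing[OF assms(2)], intro exI conjI)
    fix t :: real assume t: "q \<le> t" "t \<le> p"
    show "(h has_field_derivative (ln t - ln q + 1 + ln_Gamma (q + 1) / q - Digamma (t + 1) - d / q)) (at t)"
      unfolding h_def using t assms by (auto intro!: derivative_eq_intros simp: field_simps)
    have "ln q - Digamma (q + 1) \<le> ln t - Digamma (t + 1)"
      by (rule ln_minus_Digamma_mono) (use t assms in auto)
    moreover have "d / q \<le> (q + ln_Gamma (q + 1) - q * Digamma (q + 1)) / q"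
      using ln_share_bound_le[OF assms(1)] assms by (intro divide_right_mono) (auto simp: d_def)
    moreover have "(q + ln_Gamma (q + 1) - q * Digamma (q + 1)) / q = 1 + ln_Gamma (q + 1) / q - Digamma (q + 1)"
      using assms by (simp add: field_simps)
    ultimately show "0 \<le> ln t - ln q + 1 + ln_Gamma (q + 1) / q - Digamma (t + 1) - d / q"
      by linarith
  qed
  moreover have "h q = 0" using assms by (simp add: h_def)
  ultimately have "ln_Gamma (p + 1) + (p / q - 1) * d \<le> p * ln (p / q) + p / q * ln_Gamma (q + 1)"
    using assms by (simp add: h_def ln_div)
  then have "exp (ln_Gamma (p + 1) + (p / q - 1) * d) \<le> exp (p * ln (p / q) + p / q * ln_Gamma (q + 1))"
    by simp
  moreover have "Gamma (p + 1) > 0" "Gamma (q + 1) > 0" "share_bound q > 0"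
    using assms share_bound_pos[of q] Gamma_real_pos[of "q + 1"] Gamma_real_pos[of "p + 1"] by auto
  ultimately show ?thesis
    using assms by (simp add: exp_add powr_def d_def ln_Gamma_real_pos less_imp_neq[THEN not_sym])
qed

subsection \<open>Moments and tails\<close>

text \<open>Write \<open>max y 0 powr p\<close> as the integral of \<open>p * t powr (p - 1)\<close>
  over \<open>0 < t <= y\<close> and exchange the integrals.\<close>

lemma layer_cake_powr:
  fixes Y :: "'a \<Rightarrow> real"
  assumes "sigma_finite_measure M" and [measurable]: "Y \<in> borel_measurable M" and p: "0 < p"
  shows "(\<integral>\<^sup>+\<omega>. ennreal (max (Y \<omega>) 0 powr p) \<partial>M)
    = (\<integral>\<^sup>+t. ennreal (p * t powr (p - 1)) * emeasure M {\<omega> \<in> space M. t \<le> Y \<omega>} * indicator {0<..} t \<partial>lborel)"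
proof -
  interpret sigma_finite_measure M by fact
  interpret pair_sigma_finite M lborel by unfold_locales
  define k where "k = (\<lambda>t y::real. ennreal (p * t powr (p - 1)) * indicator {0<..} t * (if t \<le> y then 1 else 0))"
  have [measurable]: "(\<lambda>(\<omega>, t). k t (Y \<omega>)) \<in> borel_measurable (M \<Otimes>\<^sub>M lborel)"
    unfolding k_def by measurable
  have inner: "ennreal (max y 0 powr p) = (\<integral>\<^sup>+t. k t y \<partial>lborel)" for y
  proof -
    define c where "c = max y 0"
    have "((\<lambda>t. t powr (p - 1)) has_integral (c powr p / p)) {0..c}"
      using has_integral_powr_from_0[of "p - 1" c] p by (simp add: c_def)
    then have "((\<lambda>t. p * t powr (p - 1)) has_integral (p * (c powr p / p))) {0..c}"
      by (rule has_integral_mult_right)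
    then have "((\<lambda>t. if t \<in> {0..c} then p * t powr (p - 1) else 0) has_integral (c powr p)) UNIV"
      using p by (simp only: has_integral_restrict_UNIV) simp
    then have "(\<integral>\<^sup>+t. ennreal (if t \<in> {0..c} then p * t powr (p - 1) else 0) \<partial>lborel) = ennreal (c powr p)"
      using p by (intro nn_integral_has_integral_lborel) auto
    \<comment> \<open>At \<open>t = 0\<close> both sides vanish because
      \<open>0 powr (p - 1) = 0\<close>, even for \<open>p = 1\<close>.\<close>
    moreover have "ennreal (if t \<in> {0..c} then p * t powr (p - 1) else 0) = k t y" for t
      by (cases "t = 0") (auto simp: k_def c_def indicator_def)
    ultimately show ?thesis by (simp add: c_def)
  qed
  have "(\<integral>\<^sup>+\<omega>. ennreal (max (Y \<omega>) 0 powr p) \<partial>M) = (\<integral>\<^sup>+\<omega>. (\<integral>\<^sup>+t. k t (Y \<omega>) \<partial>lborel) \<partial>M)"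
    by (simp add: inner)
  also have "\<dots> = (\<integral>\<^sup>+t. (\<integral>\<^sup>+\<omega>. k t (Y \<omega>) \<partial>M) \<partial>lborel)"
    by (rule Fubini'[symmetric]) simp
  also have "\<dots> = (\<integral>\<^sup>+t. ennreal (p * t powr (p - 1)) * emeasure M {\<omega> \<in> space M. t \<le> Y \<omega>} * indicator {0<..} t \<partial>lborel)"
  proof (rule nn_integral_cong)
    fix t :: real
    have "(\<integral>\<^sup>+\<omega>. k t (Y \<omega>) \<partial>M) = (\<integral>\<^sup>+\<omega>. (ennreal (p * t powr (p - 1)) * indicator {0<..} t) * indicator {\<omega> \<in> space M. t \<le> Y \<omega>} \<omega> \<partial>M)"
      by (rule nn_integral_cong) (auto simp: k_def)
    also have "\<dots> = (ennreal (p * t powr (p - 1)) * indicator {0<..} t) * emeasure M {\<omega> \<in> space M. t \<le> Y \<omega>}"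
      by (rule nn_integral_cmult_indicator) simp
    finally show "(\<integral>\<^sup>+\<omega>. k t (Y \<omega>) \<partial>M) = ennreal (p * t powr (p - 1)) * emeasure M {\<omega> \<in> space M. t \<le> Y \<omega>} * indicator {0<..} t"
      by (simp add: ac_simps)
  qed
  finally show ?thesis .
qed

section \<open>Moments as functionals of the tail, compared with exponential tails\<close>

text \<open>By \<open>layer_cake_powr\<close> this is the \<open>p\<close>-th moment of the positive
  part of a variable with tail \<open>T\<close>. As a functional of \<open>T\<close> it also accepts
  exponentials of total mass \<open>w\<close>, without a random variable behind them.\<close>

definition tail_moment :: "real \<Rightarrow> (real \<Rightarrow> real) \<Rightarrow> ennreal" where
  "tail_moment p T = (\<integral>\<^sup>+t. ennreal (p * t powr (p - 1)) * ennreal (T t) * indicator {0<..} t \<partial>lborel)"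

lemma tail_moment_exp:
  assumes "0 < p" "0 < \<mu>" "0 \<le> w"
  shows "tail_moment p (\<lambda>t. w * exp (- t / \<mu>)) = ennreal (w * Gamma (p + 1) * \<mu> powr p)"
proof -
  define f where "f = (\<lambda>t. ennreal (indicator {0..} t * t powr (p - 1) / exp t))"
  have [measurable]: "f \<in> borel_measurable borel" unfolding f_def by measurable
  have "ennreal (Gamma p) = (\<integral>\<^sup>+t. f t \<partial>lborel)"
    unfolding f_def by (rule Gamma_conv_nn_integral_real) fact
  also have "\<dots> = ennreal (1 / \<mu>) * (\<integral>\<^sup>+t. f (t / \<mu>) \<partial>lborel)"
    using nn_integral_real_affine[of f "1 / \<mu>" 0] assms by simp
  finally have G: "ennreal (Gamma p) = ennreal (1 / \<mu>) * (\<integral>\<^sup>+t. f (t / \<mu>) \<partial>lborel)" .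
  have "tail_moment p (\<lambda>t. w * exp (- t / \<mu>)) = (\<integral>\<^sup>+t. ennreal (p * w * \<mu> powr (p - 1)) * f (t / \<mu>) \<partial>lborel)"
    unfolding tail_moment_def
  proof (rule nn_integral_cong)
    fix t :: real
    show "ennreal (p * t powr (p - 1)) * ennreal (w * exp (- t / \<mu>)) * indicator {0<..} t
      = ennreal (p * w * \<mu> powr (p - 1)) * f (t / \<mu>)"
    proof (cases "t > 0")
      case True
      have "p * t powr (p - 1) * (w * exp (- t / \<mu>)) = p * w * \<mu> powr (p - 1) * ((t / \<mu>) powr (p - 1) / exp (t / \<mu>))"
        using True assms by (simp add: powr_divide exp_minus field_simps)
      then show ?thesis using True assms by (simp add: f_def flip: ennreal_mult)
    next
      case False
      then show ?thesis using assms by (cases "t = 0") (auto simp: f_def indicator_def zero_le_divide_iff)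
    qed
  qed
  also have "\<dots> = ennreal (p * w * \<mu> powr (p - 1)) * (\<integral>\<^sup>+t. f (t / \<mu>) \<partial>lborel)"
    by (rule nn_integral_cmult) measurable
  also have "(\<integral>\<^sup>+t. f (t / \<mu>) \<partial>lborel) = ennreal (\<mu> * Gamma p)"
  proof -
    have "ennreal \<mu> * ennreal (Gamma p) = (ennreal \<mu> * ennreal (1 / \<mu>)) * (\<integral>\<^sup>+t. f (t / \<mu>) \<partial>lborel)"
      by (simp add: G mult.assoc)
    also have "ennreal \<mu> * ennreal (1 / \<mu>) = 1" using assms by (simp flip: ennreal_mult)
    finally show ?thesis using assms Gamma_real_pos[of p] by (simp add: ennreal_mult)
  qed
  also have "ennreal (p * w * \<mu> powr (p - 1)) * ennreal (\<mu> * Gamma p) = ennreal (w * (p * Gamma p) * (\<mu> powr (p - 1) * \<mu>))"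
    using assms Gamma_real_pos[of p] by (simp add: ac_simps flip: ennreal_mult)
  also have "p * Gamma p = Gamma (p + 1)"
    using Gamma_plus1[of p] assms by (auto simp: nonpos_Ints_def)
  also have "\<mu> powr (p - 1) * \<mu> = \<mu> powr p"
    using assms powr_add[of \<mu> "p - 1" 1] by simp
  finally show ?thesis .
qed

text \<open>By \<open>star\<close>, \<open>ln T\<close> lies above its chords from the point
  \<open>(0, ln w)\<close>, through which the line \<open>ln g\<close> passes. So
  \<open>T >= g\<close> holds on an initial interval only, and strictness of \<open>less\<close>
  keeps that interval bounded. Weights changing sign at its end then transfer the comparison from
  \<open>q\<close> to \<open>p\<close>.\<close>

lemma tail_moment_le_exp:
  fixes T :: "real \<Rightarrow> real"
  assumes [measurable]: "T \<in> borel_measurable borel" and nonneg: "\<And>t. 0 \<le> T t"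
    and star: "\<And>x y. 0 < x \<Longrightarrow> x < y \<Longrightarrow> w powr (1 - x / y) * T y powr (x / y) \<le> T x"
    and w: "0 < w" and q: "0 < q" "q \<le> p" and \<mu>: "0 < \<mu>"
    and less: "tail_moment q T < ennreal (w * Gamma (q + 1) * \<mu> powr q)"
  shows "tail_moment p T \<le> ennreal (w * Gamma (p + 1) * \<mu> powr p)"
proof -
  define g where "g = (\<lambda>t. w * exp (- t / \<mu>))"
  have [measurable]: "g \<in> borel_measurable borel" unfolding g_def by measurable
  have gpos: "g t > 0" for t using w by (simp add: g_def)
  have Jg: "tail_moment s g = ennreal (w * Gamma (s + 1) * \<mu> powr s)" if "s > 0" for s
    unfolding g_def using tail_moment_exp[of s \<mu> w] that \<mu> w by simp
  define S where "S = {x. 0 < x \<and> g x \<le> T x}"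
  have down: "t \<in> S" if "x \<in> S" "0 < t" "t \<le> x" for x t
  proof (cases "t = x")
    case False
    then have t: "0 < t" "t < x" using that by auto
    have "ln (g t) = (1 - t / x) * ln w + t / x * ln (g x)"
      using w t by (simp add: g_def ln_mult field_simps)
    then have "g t = w powr (1 - t / x) * g x powr (t / x)"
      using w gpos[of t] gpos[of x] by (metis exp_add exp_ln powr_def less_numeral_extra(3))
    also have "\<dots> \<le> w powr (1 - t / x) * T x powr (t / x)"
      using that gpos[of x] t by (intro mult_left_mono powr_mono2) (auto simp: S_def)
    also have "\<dots> \<le> T t" using star t by simp
    finally show ?thesis using t by (simp add: S_def)
  qed (use that in simp)
  have "\<exists>B. \<forall>x\<in>S. x \<le> B"
  proof (rule ccontr)
    assume "\<not> ?thesis"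
    then have "\<exists>x\<in>S. t \<le> x" for t
      by (meson le_cases)
    then have "g t \<le> T t" if "0 < t" for t
      using that down[of _ t] unfolding S_def by blast
    then have "tail_moment q g \<le> tail_moment q T"
      unfolding tail_moment_def by (intro nn_integral_mono) (auto simp: indicator_def intro!: mult_left_mono ennreal_leI)
    with less Jg[of q] q show False by simp
  qed
  then have "bdd_above S" by (auto simp: bdd_above_def)
  \<comment> \<open>Inserting \<open>0\<close> covers an empty \<open>S\<close>, where
    \<open>x1 = 0\<close>.\<close>
  then have bdd: "bdd_above (insert 0 S)" by simp
  define x1 where "x1 = Sup (insert 0 S)"
  have x1: "0 \<le> x1" unfolding x1_def using bdd by (intro cSup_upper) auto
  have above: "T t \<le> g t" if "x1 < t" for t
    using that cSup_upper[OF _ bdd, of t] x1 by (force simp: x1_def S_def)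
  have below: "g t \<le> T t" if "0 < t" "t < x1" for t
  proof -
    have "\<exists>x\<in>insert 0 S. t < x"
      using that(2) unfolding x1_def by (rule less_cSupD[rotated]) simp
    then obtain x where "x \<in> insert 0 S" "t < x" by blast
    then show ?thesis using that down[of x t] by (auto simp: S_def)
  qed
  \<comment> \<open>Chosen so that \<open>p t\<^bsup>p-1\<^esup> - C q t\<^bsup>q-1\<^esup>\<close> changes sign with \<open>g - T\<close>, at \<open>x1\<close>.\<close>
  define C where "C = p / q * x1 powr (p - q)"
  have C: "0 \<le> C" using q by (simp add: C_def)
  \<comment> \<open>This says that \<open>p * t powr (p - 1) - C * (q * t powr (q - 1))\<close>
    times \<open>T t - g t\<close> is at most \<open>0\<close>. It is arranged without subtraction
    because it is integrated in \<open>ennreal\<close>, where \<open>tail_moment p T\<close> might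
    still be infinite.\<close>
  have pw: "p * t powr (p - 1) * T t + C * (q * t powr (q - 1) * g t)
      \<le> p * t powr (p - 1) * g t + C * (q * t powr (q - 1) * T t)" if t: "0 < t" for t
  proof -
    have "(t powr (p - q) - x1 powr (p - q)) * (T t - g t) \<le> 0"
    proof (cases t x1 rule: linorder_cases)
      case less
      then have "t powr (p - q) \<le> x1 powr (p - q)" using t q by (intro powr_mono2) auto
      then show ?thesis using below[of t] less t by (intro mult_nonpos_nonneg) auto
    next
      case greater
      then have "x1 powr (p - q) \<le> t powr (p - q)" using x1 q by (intro powr_mono2) auto
      then show ?thesis using above[of t] greater by (intro mult_nonneg_nonpos) auto
    qed simp
    then have "p * t powr (q - 1) * ((t powr (p - q) - x1 powr (p - q)) * (T t - g t)) \<le> 0"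
      using q by - (rule mult_nonneg_nonpos, simp, assumption)
    moreover have "t powr (p - 1) = t powr (q - 1) * t powr (p - q)"
      by (simp flip: powr_add)
    ultimately show ?thesis using q by (simp add: C_def algebra_simps)
  qed
  have split: "tail_moment p a + ennreal C * tail_moment q b
     = (\<integral>\<^sup>+t. ennreal (p * t powr (p - 1) * a t + C * (q * t powr (q - 1) * b t)) * indicator {0<..} t \<partial>lborel)"
    if [measurable]: "a \<in> borel_measurable borel" "b \<in> borel_measurable borel" and "\<And>t. 0 \<le> a t" "\<And>t. 0 \<le> b t" for a b
  proof -
    have "tail_moment p a + ennreal C * tail_moment q b
     = (\<integral>\<^sup>+t. ennreal (p * t powr (p - 1)) * ennreal (a t) * indicator {0<..} t
          + ennreal C * (ennreal (q * t powr (q - 1)) * ennreal (b t) * indicator {0<..} t) \<partial>lborel)"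
      unfolding tail_moment_def
      by (subst nn_integral_add) (auto simp: nn_integral_cmult)
    also have "\<dots> = (\<integral>\<^sup>+t. ennreal (p * t powr (p - 1) * a t + C * (q * t powr (q - 1) * b t)) * indicator {0<..} t \<partial>lborel)"
      using q C that by (intro nn_integral_cong) (auto simp: indicator_def ennreal_mult ennreal_plus)
    finally show ?thesis .
  qed
  have "tail_moment p T + ennreal C * tail_moment q g \<le> tail_moment p g + ennreal C * tail_moment q T"
    using gpos nonneg
    by (subst (1 2) split) (auto simp: less_imp_le indicator_def intro!: nn_integral_mono ennreal_leI pw)
  also have "\<dots> \<le> tail_moment p g + ennreal C * tail_moment q g"
    using less Jg[of q] q by (intro add_left_mono mult_left_mono) auto
  finally have "ennreal C * tail_moment q g + tail_moment p T \<le> ennreal C * tail_moment q g + tail_moment p g"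
    by (simp add: add.commute)
  then have "tail_moment p T \<le> tail_moment p g"
    using Jg[of q] q by (simp add: ennreal_add_left_cancel_le ennreal_mult_eq_top_iff)
  then show ?thesis using Jg[of p] q by simp
qed

text \<open>The scale \<open>\<mu>0\<close> matches the \<open>q\<close>-th moments exactly. Every
  larger scale satisfies the strict hypothesis of \<open>tail_moment_le_exp\<close>, and letting it
  decrease to \<open>\<mu>0\<close> also covers \<open>m = 0\<close>.\<close>

lemma tail_moment_comparison:
  fixes T :: "real \<Rightarrow> real"
  assumes [measurable]: "T \<in> borel_measurable borel" and nonneg: "\<And>t. 0 \<le> T t"
    and star: "\<And>x y. 0 < x \<Longrightarrow> x < y \<Longrightarrow> w powr (1 - x / y) * T y powr (x / y) \<le> T x"
    and w: "0 < w" and q: "0 < q" "q \<le> p"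
    and m: "tail_moment q T = ennreal m" "0 \<le> m"
  shows "tail_moment p T \<le> ennreal (w * Gamma (p + 1) * (m / (w * Gamma (q + 1))) powr (p / q))"
proof -
  have G: "Gamma (q + 1) > 0" "Gamma (p + 1) > 0" using q by (auto intro!: Gamma_real_pos)
  define \<mu>0 where "\<mu>0 = (m / (w * Gamma (q + 1))) powr (1 / q)"
  have bound: "tail_moment p T \<le> ennreal (w * Gamma (p + 1) * \<mu> powr p)" if "\<mu>0 < \<mu>" for \<mu>
  proof -
    have \<mu>: "0 < \<mu>" using that powr_ge_zero[of "m / (w * Gamma (q + 1))" "1 / q"] unfolding \<mu>0_def by linarith
    have "m / (w * Gamma (q + 1)) = \<mu>0 powr q"
      using q m w G by (simp add: \<mu>0_def powr_powr)
    also have "\<dots> < \<mu> powr q" using that q by (intro powr_less_mono2) (auto simp: \<mu>0_def)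
    finally have "m < w * Gamma (q + 1) * \<mu> powr q" using w G by (simp add: field_simps)
    then show ?thesis
      using m by (intro tail_moment_le_exp[OF assms(1-3) w q \<mu>]) (auto simp: ennreal_less_iff)
  qed
  have "tail_moment p T \<le> ennreal (w * Gamma (p + 1) * \<mu>0 powr p)"
  proof (rule tendsto_lowerbound)
    show "((\<lambda>\<mu>. ennreal (w * Gamma (p + 1) * \<mu> powr p)) \<longlongrightarrow> ennreal (w * Gamma (p + 1) * \<mu>0 powr p)) (at_right \<mu>0)"
    proof (intro tendsto_ennrealI tendsto_mult tendsto_const)
      show "((\<lambda>\<mu>. \<mu> powr p) \<longlongrightarrow> \<mu>0 powr p) (at_right \<mu>0)"
      proof (rule tendsto_powr'[OF tendsto_ident_at tendsto_const])
        show "\<mu>0 \<noteq> 0 \<or> 0 < p \<and> (\<forall>\<^sub>F x in at_right \<mu>0. 0 \<le> x)"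
          using q by (auto simp: \<mu>0_def intro!: eventually_mono[OF eventually_at_right_less])
      qed
    qed
    show "\<forall>\<^sub>F \<mu> in at_right \<mu>0. tail_moment p T \<le> ennreal (w * Gamma (p + 1) * \<mu> powr p)"
      by (rule eventually_mono[OF eventually_at_right_less]) (rule bound)
  qed simp
  then show ?thesis by (simp add: \<mu>0_def powr_powr)
qed

section \<open>Log-concavity of the tail\<close>

text \<open>Together with \<open>exp_neg_ge_iff\<close> this makes the set where the density
  dominates a given exponential an interval.\<close>

lemma convex_ext_between:
  assumes V: "convex_ext V" and "V x \<le> ereal (a + b * x)" "V y \<le> ereal (a + b * y)" and z: "x < z" "z < y"
  shows "V z \<le> ereal (a + b * z)"
proof -
  define v where "v = (z - x) / (y - x)"
  have v: "0 \<le> v" "v \<le> 1" using z by (auto simp: v_def divide_simps)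
  have "v * (y - x) = z - x" using z by (simp add: v_def)
  then have zeq: "(1 - v) * x + v * y = z" by (simp add: algebra_simps)
  have "V ((1 - v) * x + v * y) \<le> ereal (1 - v) * V x + ereal v * V y"
    using V v unfolding convex_ext_def by auto
  also have "\<dots> \<le> ereal (1 - v) * ereal (a + b * x) + ereal v * ereal (a + b * y)"
    using v assms by (intro add_mono ereal_mult_left_mono) auto
  also have "\<dots> = ereal (a + b * ((1 - v) * x + v * y))" by (simp add: algebra_simps)
  finally show ?thesis by (simp add: zeq)
qed

lemma exp_neg_ge_iff:
  assumes "V \<noteq> -\<infinity>"
  shows "ennreal (exp (- r)) \<le> exp_neg V \<longleftrightarrow> V \<le> ereal r"
  using assms by (cases V) (auto simp: exp_neg_def ennreal_le_iff)

text \<open>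
  Compare the density \<open>f\<close> with the exponential \<open>g\<close> that has the same tails at \<open>x\<close> and \<open>y\<close>. If \<open>f\<close> had the
  smaller tail at an intermediate \<open>z\<close>, then \<open>f \<ge> g\<close> somewhere before \<open>z\<close> and \<open>f < g\<close> somewhere between \<open>z\<close> and
  \<open>y\<close>. As \<open>{f \<ge> g}\<close> is an interval, \<open>f < g\<close> beyond \<open>y\<close>, so the tails at \<open>y\<close> would differ.
\<close>
lemma log_concave_tail_integral:
  fixes V :: "real \<Rightarrow> ereal" and T :: "real \<Rightarrow> real"
  assumes V: "convex_ext V" and [measurable]: "(\<lambda>x. exp_neg (V x)) \<in> borel_measurable borel"
    and T: "\<And>s. (\<integral>\<^sup>+t. exp_neg (V t) * indicator {s..} t \<partial>lborel) = ennreal (T s)" "\<And>s. 0 \<le> T s"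
    and uv: "0 < u" "0 < v" "u + v = 1" and xy: "x < y"
  shows "T x powr u * T y powr v \<le> T (u * x + v * y)"
proof -
  define f where "f = (\<lambda>t. exp_neg (V t))"
  have [measurable]: "f \<in> borel_measurable borel" unfolding f_def by measurable
  have F: "(\<integral>\<^sup>+t. f t * indicator {s..} t \<partial>lborel) = ennreal (T s)" for s
    using T by (simp add: f_def)
  have split: "(\<integral>\<^sup>+t. h t * indicator {s..} t \<partial>lborel)
      = (\<integral>\<^sup>+t. h t * indicator {s..<r} t \<partial>lborel) + (\<integral>\<^sup>+t. h t * indicator {r..} t \<partial>lborel)"
    if [measurable]: "h \<in> borel_measurable borel" and "s \<le> r" for h :: "real \<Rightarrow> ennreal" and s r
  proof -
    have "(\<integral>\<^sup>+t. h t * indicator {s..} t \<partial>lborel)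
        = (\<integral>\<^sup>+t. h t * indicator {s..<r} t + h t * indicator {r..} t \<partial>lborel)"
      using that by (intro nn_integral_cong) (auto simp: indicator_def)
    then show ?thesis by (simp add: nn_integral_add)
  qed
  have antimono: "T r \<le> T s" if "s \<le> r" for s r
  proof -
    have "ennreal (T r) \<le> ennreal (T s)" using split[OF _ that, of f] by (simp add: F)
    then show ?thesis using T(2) by simp
  qed
  define z where "z = u * x + v * y"
  have u_eq: "u = 1 - v" using uv by simp
  have zx: "z - x = v * (y - x)" and yz: "y - z = u * (y - x)"
    by (simp_all add: z_def u_eq algebra_simps)
  have "0 < v * (y - x)" "0 < u * (y - x)" using uv xy by auto
  then have z: "x < z" "z < y" using zx yz by auto
  \<comment> \<open>Equal positive tails are separated because the interpolating exponential would
    have rate \<open>b = 0\<close>.\<close>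
  consider "T y = 0" | "0 < T y" "T x = T y" | "0 < T y" "T y < T x"
    using T(2)[of y] antimono[of x y] xy by fastforce
  then have "T x powr u * T y powr v \<le> T z"
  proof cases
    case 1
    then show ?thesis using T(2) by simp
  next
    case 2
    then show ?thesis using antimono[of z y] z uv by (simp flip: powr_add)
  next
    case 3
    \<comment> \<open>\<open>G\<close> is the exponential agreeing with \<open>T\<close> at
      \<open>x\<close> and \<open>y\<close>, and \<open>b\<close> is its decay rate;
      \<open>a\<close> is chosen so that \<open>g = b * G\<close> is the density with tail
      \<open>G\<close>.\<close>
    define b where "b = (ln (T x) - ln (T y)) / (y - x)"
    have b: "0 < b" using 3 xy by (simp add: b_def)
    define a where "a = - ln b - ln (T x) - b * x"
    define g where "g = (\<lambda>t. exp (- (a + b * t)))"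
    define G where "G = (\<lambda>s. exp (ln (T x) + b * (x - s)))"
    have [measurable]: "g \<in> borel_measurable borel" unfolding g_def by measurable
    have bG: "g t = b * G t" for t
      using b by (simp add: g_def G_def a_def exp_add[symmetric] algebra_simps flip: exp_minus) (simp add: exp_diff exp_add exp_minus field_simps)
    have IG: "(\<integral>\<^sup>+t. ennreal (g t) * indicator {s..} t \<partial>lborel) = ennreal (G s)" for s
    proof -
      have "(\<integral>\<^sup>+t. ennreal (g t) * indicator {s..} t \<partial>lborel) = ennreal (0 - (- G s))"
      proof (rule nn_integral_FTC_atLeast)
        show "((\<lambda>s. - G s) has_real_derivative g t) (at t)" for t
          unfolding bG G_def by (auto intro!: derivative_eq_intros)
        show "((\<lambda>s. - G s) \<longlongrightarrow> 0) at_top"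
          unfolding G_def using b by real_asymp
      qed (auto simp: g_def)
      then show ?thesis by simp
    qed
    have Gx: "G x = T x" using 3 by (simp add: G_def)
    have Gy: "G y = T y"
    proof -
      have "b * (x - y) = ln (T y) - ln (T x)" using xy by (simp add: b_def field_simps)
      then show ?thesis using 3 by (simp add: G_def)
    qed
    have Gz: "G z = T x powr u * T y powr v"
    proof -
      have "b * (x - z) = - (b * (z - x))" by (simp add: algebra_simps)
      also have "\<dots> = - (v * (b * (y - x)))" by (simp add: zx)
      also have "b * (y - x) = ln (T x) - ln (T y)" using xy by (simp add: b_def)
      finally have "G z = exp (u * ln (T x) + v * ln (T y))"
        by (simp add: G_def u_eq algebra_simps)
      then show ?thesis using 3 by (simp add: powr_def exp_add)
    qed
    have ge_iff: "ennreal (g t) \<le> f t \<longleftrightarrow> V t \<le> ereal (a + b * t)" for t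
      using exp_neg_ge_iff[of "V t" "a + b * t"] V by (simp add: g_def f_def convex_ext_def)
    show ?thesis
    proof (rule ccontr)
      assume "\<not> ?thesis"
      then have less: "T z < G z" by (simp add: Gz)
      have "\<exists>p1. x \<le> p1 \<and> p1 < z \<and> ennreal (g p1) \<le> f p1"
      proof (rule ccontr)
        assume "\<not> ?thesis"
        then have "f t * indicator {x..<z} t \<le> ennreal (g t) * indicator {x..<z} t" for t
          by (force simp: indicator_def)
        then have *: "(\<integral>\<^sup>+t. f t * indicator {x..<z} t \<partial>lborel) \<le> (\<integral>\<^sup>+t. ennreal (g t) * indicator {x..<z} t \<partial>lborel)"
          by (rule nn_integral_mono)
        have eq: "(\<integral>\<^sup>+t. ennreal (g t) * indicator {x..<z} t \<partial>lborel) + ennreal (G z) = ennreal (G x)"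
          using split[of "\<lambda>t. ennreal (g t)" x z] z by (simp add: IG)
        define I where "I = (\<integral>\<^sup>+t. ennreal (g t) * indicator {x..<z} t \<partial>lborel)"
        have "I \<noteq> \<infinity>" using eq by (auto simp: I_def)
        have "ennreal (T x) \<le> I + ennreal (T z)"
          using split[of f x z] z * by (simp add: F I_def add_right_mono)
        also have "\<dots> < I + ennreal (G z)"
          using less T(2) \<open>I \<noteq> \<infinity>\<close> by (simp add: ennreal_add_left_cancel_less ennreal_less_iff)
        also have "\<dots> = ennreal (T x)" using eq by (simp add: I_def Gx)
        finally show False by simp
      qed
      then obtain p1 where p1: "x \<le> p1" "p1 < z" "ennreal (g p1) \<le> f p1" by blast
      have "\<exists>p2. z \<le> p2 \<and> p2 < y \<and> f p2 < ennreal (g p2)"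
      proof (rule ccontr)
        assume "\<not> ?thesis"
        then have "ennreal (g t) * indicator {z..<y} t \<le> f t * indicator {z..<y} t" for t
          by (force simp: indicator_def not_less)
        then have "(\<integral>\<^sup>+t. ennreal (g t) * indicator {z..<y} t \<partial>lborel) \<le> (\<integral>\<^sup>+t. f t * indicator {z..<y} t \<partial>lborel)"
          by (rule nn_integral_mono)
        then have "ennreal (G z) \<le> ennreal (T z)"
          using split[of f z y] split[of "\<lambda>t. ennreal (g t)" z y] z by (simp add: F IG Gy add_right_mono)
        then show False using less T(2) by (simp add: ennreal_le_iff)
      qed
      then obtain p2 where p2: "z \<le> p2" "p2 < y" "f p2 < ennreal (g p2)" by blast
      have lt: "f t < ennreal (g t)" if "y \<le> t" for t
      proof (rule ccontr)
        assume "\<not> ?thesis"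
        then have "ennreal (g p2) \<le> f p2"
          using convex_ext_between[OF V, of p1 a b t p2] p1 p2 that by (simp add: ge_iff not_less)
        then show False using p2 by simp
      qed
      have "(\<integral>\<^sup>+t. f t * indicator {y..} t \<partial>lborel) < (\<integral>\<^sup>+t. ennreal (g t) * indicator {y..} t \<partial>lborel)"
      proof (rule nn_integral_less)
        show "(\<integral>\<^sup>+t. f t * indicator {y..} t \<partial>lborel) \<noteq> \<infinity>" by (simp add: F)
        show "AE t in lborel. f t * indicator {y..} t \<le> ennreal (g t) * indicator {y..} t"
          using lt by (auto simp: indicator_def less_imp_le)
        show "\<not> (AE t in lborel. ennreal (g t) * indicator {y..} t \<le> f t * indicator {y..} t)"
        proof
          assume "AE t in lborel. ennreal (g t) * indicator {y..} t \<le> f t * indicator {y..} t"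
          then have "AE t in lborel. t \<notin> {y..}"
          proof eventually_elim
            case (elim t)
            then show ?case using lt[of t] by (cases "y \<le> t") auto
          qed
          then have "emeasure lborel {y..} = 0"
            by (subst (asm) AE_iff_measurable[of "{y..}"]) auto
          moreover have "emeasure lborel {y..y+1} \<le> emeasure lborel {y..}"
            by (rule emeasure_mono) auto
          ultimately show False by simp
        qed
      qed measurable
      then show False by (simp add: F IG Gy)
    qed
  qed
  then show ?thesis by (simp add: z_def)
qed

text \<open>The power function lies above its tangent at \<open>t\<close>; Young's inequality with
  exponents \<open>1 / q\<close> and \<open>1 - 1 / q\<close> gives this directly.\<close>

lemma powr_tangent:
  fixes x t q :: real
  assumes "0 \<le> x" "0 < t" "1 \<le> q"
  shows "q * t powr (q - 1) * x \<le> x powr q + (q - 1) * t powr q"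
proof (cases "x = 0")
  case False
  then have "(x powr q) powr (1 / q) * (t powr q) powr (1 - 1 / q) \<le> 1 / q * x powr q + (1 - 1 / q) * t powr q"
    using assms by (intro Youngs_inequality_0) auto
  moreover have "(x powr q) powr (1 / q) = x" "(t powr q) powr (1 - 1 / q) = t powr (q - 1)"
    using assms by (auto simp: powr_powr algebra_simps)
  ultimately have "q * (x * t powr (q - 1)) \<le> q * (1 / q * x powr q + (1 - 1 / q) * t powr q)"
    using assms by (intro mult_left_mono) auto
  then show ?thesis using assms by (simp add: algebra_simps)
qed (use assms in simp)

subsection \<open>Mean-zero log-concave random variables\<close>

text \<open>The case with a density; the almost surely constant case is settled in the final
  theorem. The setting is stable under reflection, so one-sided lemmas about \<open>X\<close> serve
  for both sides.\<close>

locale centered_log_concave = prob_space M for M :: "'a measure" +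
  fixes X :: "'a \<Rightarrow> real" and V :: "real \<Rightarrow> ereal"
  assumes rv [measurable]: "X \<in> borel_measurable M"
    and V: "convex_ext V"
    and dist: "distributed M lborel X (\<lambda>x. exp_neg (V x))"
    and int: "integrable M X"
    and mean: "expectation X = 0"
begin

definition tail :: "real \<Rightarrow> real" where "tail x = prob {\<omega> \<in> space M. x \<le> X \<omega>}"

definition pos_moment :: "real \<Rightarrow> ennreal" where "pos_moment p = (\<integral>\<^sup>+\<omega>. ennreal (max (X \<omega>) 0 powr p) \<partial>M)"

definition pos_mean :: real where "pos_mean = expectation (\<lambda>\<omega>. max (X \<omega>) 0)"

lemma tail_nonneg: "0 \<le> tail x" by (simp add: tail_def)

lemma tail_antimono: "x \<le> y \<Longrightarrow> tail y \<le> tail x"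
  unfolding tail_def by (rule finite_measure_mono) auto

lemma tail_measurable [measurable]: "tail \<in> borel_measurable borel"
proof -
  have "mono (\<lambda>x. - tail x)" using tail_antimono by (auto simp: mono_def)
  then have "(\<lambda>x. - (- tail x)) \<in> borel_measurable borel"
    by (intro borel_measurable_uminus borel_measurable_mono)
  then show ?thesis by simp
qed

lemma density_measurable [measurable]: "(\<lambda>x. exp_neg (V x)) \<in> borel_measurable borel"
  using dist by (simp add: distributed_def)

lemma tail_log_concave:
  assumes "0 < u" "0 < v" "u + v = 1" "x < y"
  shows "tail x powr u * tail y powr v \<le> tail (u * x + v * y)"
proof (rule log_concave_tail_integral[OF V density_measurable _ tail_nonneg assms])
  fix s
  have "emeasure M (X -` {s..} \<inter> space M) = (\<integral>\<^sup>+t. exp_neg (V t) * indicator {s..} t \<partial>lborel)"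
    by (rule distributed_emeasure[OF dist]) simp
  moreover have "X -` {s..} \<inter> space M = {\<omega> \<in> space M. s \<le> X \<omega>}" by auto
  ultimately show "(\<integral>\<^sup>+t. exp_neg (V t) * indicator {s..} t \<partial>lborel) = ennreal (tail s)"
    by (simp add: tail_def emeasure_eq_measure)
qed

lemma no_atom: "prob {\<omega> \<in> space M. X \<omega> = c} = 0"
proof -
  have "emeasure M (X -` {c} \<inter> space M) = (\<integral>\<^sup>+t. exp_neg (V t) * indicator {c} t \<partial>lborel)"
    by (rule distributed_emeasure[OF dist]) simp
  also have "\<dots> = 0"
    using AE_lborel_singleton[of c] by (subst nn_integral_0_iff_AE) (auto elim!: eventually_mono)
  also have "X -` {c} \<inter> space M = {\<omega> \<in> space M. X \<omega> = c}" by auto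
  finally show ?thesis by (simp add: measure_def)
qed

lemma tail_moment_shift:
  assumes "0 < p"
  shows "(\<integral>\<^sup>+\<omega>. ennreal (max (X \<omega> - x) 0 powr p) \<partial>M) = tail_moment p (\<lambda>t. tail (x + t))"
  using layer_cake_powr[of M "\<lambda>\<omega>. X \<omega> - x" p] assms sigma_finite_measure_axioms
  by (simp add: tail_moment_def tail_def emeasure_eq_measure le_diff_eq add.commute)

lemma pos_moment_eq: "0 < p \<Longrightarrow> pos_moment p = tail_moment p tail"
  using tail_moment_shift[of p 0] by (simp add: pos_moment_def)

lemma int_pos: "integrable M (\<lambda>\<omega>. max (X \<omega> - x) 0)"
  using int by (intro integrable_max Bochner_Integration.integrable_diff) auto

lemma nn_integral_pos:
  "(\<integral>\<^sup>+\<omega>. ennreal (max (X \<omega> - x) 0 powr 1) \<partial>M) = ennreal (expectation (\<lambda>\<omega>. max (X \<omega> - x) 0))"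
  using nn_integral_eq_integral[OF int_pos[of x]] by simp

lemma pos_moment_1: "pos_moment 1 = ennreal pos_mean"
  using nn_integral_pos[of 0] by (simp add: pos_moment_def pos_mean_def)

lemma pos_mean_nonneg: "0 \<le> pos_mean" by (simp add: pos_mean_def)

text \<open>Otherwise \<open>X <= 0\<close> almost surely, and mean zero would put all mass at
  \<open>0\<close>, contradicting \<open>no_atom\<close>.\<close>

lemma pos_mean_pos: "0 < pos_mean"
proof (rule ccontr)
  assume "\<not> 0 < pos_mean"
  then have a0: "pos_mean = 0" using pos_mean_nonneg by simp
  then have "AE \<omega> in M. max (X \<omega>) 0 = 0"
    using int_pos[of 0] unfolding pos_mean_def by (subst (asm) integral_nonneg_eq_0_iff_AE) auto
  then have "AE \<omega> in M. 0 \<le> - X \<omega>" by eventually_elim auto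
  moreover have "integrable M (\<lambda>\<omega>. - X \<omega>)" "expectation (\<lambda>\<omega>. - X \<omega>) = 0" using int mean by auto
  ultimately have "AE \<omega> in M. - X \<omega> = 0" using integral_nonneg_eq_0_iff_AE by blast
  then have "AE \<omega> in M. \<omega> \<in> {\<omega> \<in> space M. X \<omega> = 0}" by auto
  then have "prob {\<omega> \<in> space M. X \<omega> = 0} = 1" by (subst prob_eq_1) auto
  then show False using no_atom by simp
qed

lemma ex_tail_pos: "\<exists>y>0. 0 < tail y"
proof (rule ccontr)
  assume "\<not> ?thesis"
  then have "tail t = 0" if "0 < t" for t using tail_nonneg[of t] that by force
  then have "tail_moment 1 tail = 0"
    unfolding tail_moment_def by (intro nn_integral_zero' AE_I2) (auto simp: indicator_def)
  then show False using pos_moment_eq[of 1] pos_moment_1 pos_mean_pos by simp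
qed

lemma tail_0_pos: "0 < tail 0"
  using ex_tail_pos tail_antimono by (meson less_le_trans less_imp_le)

text \<open>The hypothesis \<open>star\<close> of the exponential comparison, with
  \<open>w = tail 0\<close>.\<close>

lemma tail_star:
  assumes "0 < x" "x < y"
  shows "tail 0 powr (1 - x / y) * tail y powr (x / y) \<le> tail x"
  using tail_log_concave[of "1 - x / y" "x / y" 0 y] assms by simp

lemma pos_moment_comparison:
  assumes "0 < q" "q \<le> p" "pos_moment q = ennreal r" "0 \<le> r"
  shows "pos_moment p \<le> ennreal (tail 0 * Gamma (p + 1) * (r / (tail 0 * Gamma (q + 1))) powr (p / q))"
  using tail_moment_comparison[OF tail_measurable tail_nonneg tail_star tail_0_pos assms(1,2)] assms
  by (simp add: pos_moment_eq)

text \<open>The comparison started from the first moment, where \<open>Gamma 2 = 1\<close>. It also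
  yields finiteness of all moments of order at least \<open>1\<close>.\<close>

lemma pos_moment_upper:
  assumes "1 \<le> p"
  shows "pos_moment p \<le> ennreal (Gamma (p + 1) * tail 0 powr (1 - p) * pos_mean powr p)"
proof -
  have "tail 0 * Gamma (p + 1) * (pos_mean / tail 0) powr p = Gamma (p + 1) * tail 0 powr (1 - p) * pos_mean powr p"
    using pos_mean_pos tail_0_pos by (simp add: powr_divide powr_diff)
  moreover have "pos_moment p \<le> ennreal (tail 0 * Gamma (p + 1) * (pos_mean / tail 0) powr p)"
    using pos_moment_comparison[OF _ assms pos_moment_1 pos_mean_nonneg] by (simp add: Gamma_numeral)
  ultimately show ?thesis by (simp only:)
qed

lemma pos_moment_finite: "1 \<le> p \<Longrightarrow> pos_moment p = ennreal (enn2real (pos_moment p))"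
  using le_less_trans[OF pos_moment_upper ennreal_less_top] by simp

text \<open>Jensen's inequality conditional on \<open>X >= 0\<close>, obtained by integrating
  \<open>powr_tangent\<close> over that event at the conditional mean \<open>t\<close>.\<close>

lemma pos_moment_lower:
  assumes q: "1 \<le> q"
  shows "tail 0 powr (1 - q) * pos_mean powr q \<le> enn2real (pos_moment q)"
proof -
  define t where "t = pos_mean / tail 0"
  have t: "0 < t" using pos_mean_pos tail_0_pos by (simp add: t_def)
  have intq: "integrable M (\<lambda>\<omega>. max (X \<omega>) 0 powr q)"
    using pos_moment_finite[OF q] by (intro integrableI_nonneg) (auto simp: pos_moment_def top.not_eq_extremum[symmetric] intro: ennreal_neq_top)
  have mq: "enn2real (pos_moment q) = expectation (\<lambda>\<omega>. max (X \<omega>) 0 powr q)"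
    using intq by (simp add: pos_moment_def nn_integral_eq_integral)
  define A where "A = {\<omega> \<in> space M. 0 \<le> X \<omega>}"
  have [measurable]: "A \<in> sets M" by (simp add: A_def)
  have "expectation (\<lambda>\<omega>. q * t powr (q - 1) * max (X \<omega>) 0) \<le> expectation (\<lambda>\<omega>. max (X \<omega>) 0 powr q + (q - 1) * t powr q * indicator A \<omega>)"
  proof (rule integral_mono)
    show "integrable M (\<lambda>\<omega>. q * t powr (q - 1) * max (X \<omega>) 0)" using int_pos[of 0] by simp
    show "integrable M (\<lambda>\<omega>. max (X \<omega>) 0 powr q + (q - 1) * t powr q * indicator A \<omega>)"
      using intq by (intro Bochner_Integration.integrable_add integrable_mult_right) (auto simp: emeasure_eq_measure)
    fix \<omega> assume "\<omega> \<in> space M"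
    then show "q * t powr (q - 1) * max (X \<omega>) 0 \<le> max (X \<omega>) 0 powr q + (q - 1) * t powr q * indicator A \<omega>"
      using powr_tangent[of "X \<omega>" t q] t q by (cases "0 \<le> X \<omega>") (auto simp: A_def)
  qed
  also have "\<dots> = enn2real (pos_moment q) + (q - 1) * t powr q * tail 0"
    using intq by (subst Bochner_Integration.integral_add) (auto simp: mq tail_def A_def emeasure_eq_measure)
  finally have "q * t powr (q - 1) * pos_mean \<le> enn2real (pos_moment q) + (q - 1) * t powr q * tail 0"
    by (simp add: pos_mean_def)
  moreover have "t powr (q - 1) * pos_mean = t powr q * tail 0"
    using t tail_0_pos by (simp add: powr_diff) (simp add: t_def)
  ultimately have "t powr q * tail 0 \<le> enn2real (pos_moment q)" by (simp add: algebra_simps)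
  moreover have "t powr q * tail 0 = tail 0 powr (1 - q) * pos_mean powr q"
    using pos_mean_pos tail_0_pos by (simp add: t_def powr_divide powr_diff)
  ultimately show ?thesis by simp
qed

text \<open>
  \<open>- c\<close> is the largest slope of a chord of \<open>ln tail\<close> from \<open>0\<close> to the right; by concavity the slopes of the
  chords to the left are at least \<open>- c\<close>.
\<close>
lemma tail_le_exp: "\<exists>c\<ge>0. \<forall>x. tail x \<le> tail 0 * exp (- c * x)"
proof -
  \<comment> \<open>Points with vanishing tail are excluded, since \<open>ln 0\<close> is only a
    default value.\<close>
  define A where "A = {(ln (tail 0) - ln (tail y)) / y | y. 0 < y \<and> 0 < tail y}"
  have ne: "A \<noteq> {}" using ex_tail_pos by (auto simp: A_def)
  have nonneg: "0 \<le> s" if "s \<in> A" for s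
  proof -
    obtain y where y: "s = (ln (tail 0) - ln (tail y)) / y" "0 < y" "0 < tail y" using \<open>s \<in> A\<close> by (auto simp: A_def)
    then show ?thesis using tail_antimono[of 0 y] by simp
  qed
  have bdd: "bdd_below A" using nonneg by (auto simp: bdd_below_def)
  define c where "c = Inf A"
  have "0 \<le> c" unfolding c_def using ne nonneg by (intro cInf_greatest)
  moreover have "tail x \<le> tail 0 * exp (- c * x)" for x
  proof (cases x "0 :: real" rule: linorder_cases)
    case equal then show ?thesis by simp
  next
    case greater
    show ?thesis
    proof (cases "tail x = 0")
      case True then show ?thesis using tail_0_pos by simp
    next
      case False
      then have Tx: "0 < tail x" using tail_nonneg[of x] by simp
      then have "c \<le> (ln (tail 0) - ln (tail x)) / x"
        unfolding c_def using greater bdd by (intro cInf_lower) (auto simp: A_def)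
      then have "ln (tail x) \<le> ln (tail 0) + (- c * x)" using greater by (simp add: field_simps)
      then have "exp (ln (tail x)) \<le> exp (ln (tail 0) + (- c * x))" by simp
      then show ?thesis using Tx tail_0_pos by (simp add: exp_diff exp_minus field_simps)
    qed
  next
    case less
    have Tx: "0 < tail x" using tail_antimono[of x 0] less tail_0_pos by simp
    have "(ln (tail x) - ln (tail 0)) / (- x) \<le> c"
      unfolding c_def
    proof (rule cInf_greatest[OF ne])
      fix s assume "s \<in> A"
      then obtain y where s: "s = (ln (tail 0) - ln (tail y)) / y" and y: "0 < y" "0 < tail y" by (auto simp: A_def)
      have yx: "0 < y - x" using y less by simp
      \<comment> \<open>The weights that write \<open>0\<close> as a convex combination of
        \<open>x < 0 < y\<close>.\<close>
      define u v where "u = y / (y - x)" and "v = - x / (y - x)"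
      have uv: "0 < u" "0 < v" "u + v = 1" "u * x + v * y = 0"
        using y less yx by (auto simp: u_def v_def divide_simps)
      have "tail x powr u * tail y powr v \<le> tail 0"
        using tail_log_concave[of u v x y] uv y less by simp
      then have "ln (tail x powr u * tail y powr v) \<le> ln (tail 0)"
        using Tx y tail_0_pos by (intro ln_le_cancel_iff[THEN iffD2]) auto
      then have "u * ln (tail x) + v * ln (tail y) \<le> ln (tail 0)" using Tx y by (simp add: ln_mult ln_powr)
      then have "(u * ln (tail x) + v * ln (tail y)) * (y - x) \<le> ln (tail 0) * (y - x)"
        using yx by (intro mult_right_mono) auto
      moreover have "(u * ln (tail x) + v * ln (tail y)) * (y - x) = (u * (y - x)) * ln (tail x) + (v * (y - x)) * ln (tail y)"
        by (simp add: algebra_simps)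
      moreover have u: "u * (y - x) = y" and v: "v * (y - x) = - x" using yx by (simp_all add: u_def v_def)
      ultimately have "y * ln (tail x) + (- x) * ln (tail y) \<le> ln (tail 0) * (y - x)"
        by (simp only: u v)
      then have "y * (ln (tail x) - ln (tail 0)) \<le> (- x) * (ln (tail 0) - ln (tail y))"
        by (simp add: algebra_simps)
      then show "(ln (tail x) - ln (tail 0)) / (- x) \<le> s"
        using y less by (simp add: s field_simps)
    qed
    then have "ln (tail x) \<le> ln (tail 0) + (- c * x)" using less by (simp add: field_simps)
    then have "exp (ln (tail x)) \<le> exp (ln (tail 0) + (- c * x))" by simp
    then show ?thesis using Tx tail_0_pos by (simp add: exp_diff exp_minus field_simps)
  qed
  ultimately show ?thesis by blast
qed

lemma tail_lim: "(\<lambda>n. tail (- real n)) \<longlonglongrightarrow> 1"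
proof -
  have "(\<lambda>n. prob {\<omega> \<in> space M. - real n \<le> X \<omega>}) \<longlonglongrightarrow> prob (\<Union>n. {\<omega> \<in> space M. - real n \<le> X \<omega>})"
    by (rule finite_Lim_measure_incseq) (auto simp: incseq_def)
  moreover have "(\<Union>n. {\<omega> \<in> space M. - real n \<le> X \<omega>}) = space M"
  proof -
    have "\<exists>n. - real n \<le> X \<omega>" for \<omega>
      using real_arch_simple[of "- X \<omega>"] by (auto simp: minus_le_iff)
    then show ?thesis by auto
  qed
  ultimately show ?thesis by (simp add: tail_def prob_space)
qed

text \<open>
  Gruenbaum's inequality, read off from \<open>- x \<le> E (X - x)\<^sub>+\<close> at the point \<open>x\<close> where the exponential bound on the
  tail equals \<open>1\<close>.
\<close>
lemma tail_0_ge: "exp (- 1) \<le> tail 0"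
proof -
  obtain c where c: "0 \<le> c" and le: "\<And>x. tail x \<le> tail 0 * exp (- c * x)"
    using tail_le_exp by blast
  show ?thesis
  proof (cases "c = 0")
    case True
    \<comment> \<open>Without decay the tail never exceeds \<open>tail 0\<close>, while it tends to
      \<open>1\<close> at minus infinity.\<close>
    then have "1 \<le> tail 0"
      using le by (intro LIMSEQ_le_const2[OF tail_lim]) auto
    moreover have "exp (- 1 :: real) \<le> 1" by simp
    ultimately show ?thesis by linarith
  next
    case False
    then have c: "0 < c" using \<open>0 \<le> c\<close> by simp
    define x where "x = ln (tail 0) / c"
    have "ennreal (- x) \<le> ennreal (expectation (\<lambda>\<omega>. max (X \<omega> - x) 0))"
    proof (rule ennreal_leI)
      have "- x = expectation (\<lambda>\<omega>. X \<omega> - x)" using int mean by (simp add: prob_space)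
      also have "\<dots> \<le> expectation (\<lambda>\<omega>. max (X \<omega> - x) 0)"
        using int int_pos by (intro integral_mono) auto
      finally show "- x \<le> expectation (\<lambda>\<omega>. max (X \<omega> - x) 0)" .
    qed
    also have "\<dots> = tail_moment 1 (\<lambda>t. tail (x + t))"
      using tail_moment_shift[of 1 x] nn_integral_pos[of x] by simp
    also have "\<dots> \<le> tail_moment 1 (\<lambda>t. (tail 0 * exp (- c * x)) * exp (- t / (1 / c)))"
    proof -
      have "tail (x + t) \<le> (tail 0 * exp (- c * x)) * exp (- t / (1 / c))" for t
        using le[of "x + t"] by (simp add: algebra_simps exp_add[symmetric] exp_diff)
      then show ?thesis
        unfolding tail_moment_def by (intro nn_integral_mono mult_right_mono mult_left_mono ennreal_leI) auto
    qed
    also have "\<dots> = ennreal (tail 0 * exp (- c * x) * Gamma (1 + 1) * (1 / c) powr 1)"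
      using c tail_0_pos by (intro tail_moment_exp) auto
    also have "tail 0 * exp (- c * x) * Gamma (1 + 1) * (1 / c) powr 1 = 1 / c"
      using c tail_0_pos by (simp add: x_def Gamma_numeral exp_minus)
    finally have "- x \<le> 1 / c" using c by (simp add: ennreal_le_iff)
    then have "- 1 \<le> ln (tail 0)" using c by (simp add: x_def field_simps)
    then show ?thesis using tail_0_pos by (simp add: ln_ge_iff)
  qed
qed

text \<open>Transfers every statement about the positive part to the negative part.\<close>

lemma reflected: "centered_log_concave M (\<lambda>\<omega>. - X \<omega>) (\<lambda>x. V (- x))"
proof
  show "convex_ext (\<lambda>x. V (- x))"
    unfolding convex_ext_def
  proof (intro conjI allI impI)
    show "V (- x) \<noteq> - \<infinity>" for x using V by (auto simp: convex_ext_def)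
    fix x y u v :: real assume "0 \<le> u" "0 \<le> v" "u + v = 1"
    then have "V (u * (- x) + v * (- y)) \<le> ereal u * V (- x) + ereal v * V (- y)"
      using V unfolding convex_ext_def by blast
    then show "V (- (u * x + v * y)) \<le> ereal u * V (- x) + ereal v * V (- y)"
      by simp
  qed
  show "distributed M lborel (\<lambda>\<omega>. - X \<omega>) (\<lambda>x. exp_neg (V (- x)))"
    unfolding distributed_def
  proof (intro conjI)
    show "distr M lborel (\<lambda>\<omega>. - X \<omega>) = density lborel (\<lambda>x. exp_neg (V (- x)))"
    proof (rule measure_eqI)
      fix A assume "A \<in> sets (distr M lborel (\<lambda>\<omega>. - X \<omega>))"
      then have [measurable]: "A \<in> sets borel" by simp
      have [measurable]: "uminus -` A \<in> sets borel"
        using measurable_sets[of "uminus :: real \<Rightarrow> real" borel borel A] by simp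
      have "emeasure (distr M lborel (\<lambda>\<omega>. - X \<omega>)) A = emeasure M (X -` (uminus -` A) \<inter> space M)"
        by (subst emeasure_distr) (auto intro!: arg_cong[where f = "emeasure M"])
      also have "\<dots> = (\<integral>\<^sup>+t. exp_neg (V t) * indicator (uminus -` A) t \<partial>lborel)"
        by (rule distributed_emeasure[OF dist]) simp
      also have "\<dots> = (\<integral>\<^sup>+t. exp_neg (V (- t)) * indicator A t \<partial>lborel)"
      proof (subst nn_integral_real_affine[of _ "-1" 0])
        show "(\<lambda>t. exp_neg (V t) * indicator (uminus -` A) t) \<in> borel_measurable borel"
          by measurable
      qed (auto simp: indicator_def)
      also have "\<dots> = emeasure (density lborel (\<lambda>x. exp_neg (V (- x)))) A"
        by (subst emeasure_density) auto
      finally show "emeasure (distr M lborel (\<lambda>\<omega>. - X \<omega>)) A = emeasure (density lborel (\<lambda>x. exp_neg (V (- x)))) A" .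
    qed simp
  qed auto
  show "expectation (\<lambda>\<omega>. - X \<omega>) = 0" using mean int by simp
qed (use int in auto)

end

section \<open>Combining the two sides\<close>

text \<open>The bounds on \<open>r\<close> and \<open>r'\<close> share the mean \<open>a\<close>, so
  \<open>r / r'\<close> is at most \<open>Gamma (q + 1) * (w' / w) powr (q - 1)\<close>. From
  \<open>w >= 1 / e\<close> follows \<open>w' / w <= e - 1\<close>, which makes this at most
  \<open>imbalance q\<close>.\<close>

lemma one_sided_share:
  fixes w w' a r r' q :: real
  assumes q: "1 \<le> q" and w: "exp (- 1) \<le> w" "0 < w'" "w + w' = 1" and a: "0 < a"
    and r: "0 \<le> r" "r \<le> Gamma (q + 1) * w powr (1 - q) * a powr q"
    and r': "w' powr (1 - q) * a powr q \<le> r'"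
  shows "r \<le> share_bound q * w * (r + r')"
proof -
  define E where "E = exp (1::real) - 1"
  have E: "0 < E" using exp1_gt_2 by (simp add: E_def)
  have w0: "0 < w" using w(1) exp_gt_zero[of "-1::real"] by linarith
  have we: "1 \<le> w * exp 1" using w(1) by (simp add: exp_minus field_simps)
  have "w' \<le> w * E" using w we by (simp add: E_def algebra_simps)
  then have "(w * E) powr (1 - q) \<le> w' powr (1 - q)"
    using q w w0 E by (intro powr_mono2') auto
  then have "w powr (1 - q) * E powr (1 - q) * a powr q \<le> r'"
    using r' w0 E by (auto simp: powr_mult intro: order_trans[OF mult_right_mono])
  moreover have t: "0 < imbalance q" by (rule imbalance_pos[OF q])
  moreover have "r / imbalance q \<le> w powr (1 - q) * E powr (1 - q) * a powr q"
  proof -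
    have G: "0 < Gamma (q + 1)" using q by (intro Gamma_real_pos) auto
    have "r / imbalance q \<le> (Gamma (q + 1) * w powr (1 - q) * a powr q) / imbalance q"
      using r t by (intro divide_right_mono) auto
    also have "\<dots> = w powr (1 - q) * E powr (1 - q) * a powr q"
      using G E by (simp add: imbalance_def powr_diff flip: E_def)
    finally show ?thesis .
  qed
  ultimately have le: "r * (1 + 1 / imbalance q) \<le> r + r'" by (simp add: algebra_simps)
  have pos: "0 < 1 + 1 / imbalance q" using t by (simp add: add_pos_pos)
  have "r \<le> (r + r') / (1 + 1 / imbalance q)" using le pos by (simp add: pos_le_divide_eq)
  \<comment> \<open>A deliberate loss: the bound must be proportional to \<open>w\<close> to control
    \<open>r / w\<close> in \<open>two_sided_bound\<close>.\<close>
  also have "\<dots> \<le> (w * exp 1) * ((r + r') / (1 + 1 / imbalance q))"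
  proof -
    have "0 \<le> r + r'" using r r' by (smt (verit) mult_nonneg_nonneg powr_ge_zero)
    then have "0 \<le> (r + r') / (1 + 1 / imbalance q)" using pos by simp
    then show ?thesis using mult_right_mono[OF we, of "(r + r') / (1 + 1 / imbalance q)"] by (simp only: mult_1)
  qed
  also have "\<dots> = share_bound q * w * (r + r')" by (simp add: share_bound_def)
  finally show ?thesis .
qed

text \<open>Splitting \<open>(r / w) powr k\<close> into \<open>r / w\<close> and its power
  \<open>k - 1\<close>, and bounding the latter by \<open>D powr (k - 1)\<close>, makes each side
  linear in its own moment. The two sides then add up, and \<open>Gamma_share_bound\<close> absorbs
  the constants.\<close>

lemma two_sided_bound:
  fixes w w' r r' p q :: real
  assumes q: "1 \<le> q" "q \<le> p" and w: "0 < w" "0 < w'" and r: "0 < r" "0 < r'"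
    and share: "r \<le> share_bound q * w * (r + r')" "r' \<le> share_bound q * w' * (r + r')"
  shows "w * Gamma (p + 1) * (r / (w * Gamma (q + 1))) powr (p / q)
      + w' * Gamma (p + 1) * (r' / (w' * Gamma (q + 1))) powr (p / q)
    \<le> (p / q) powr p * (r + r') powr (p / q)"
proof -
  define k where "k = p / q"
  have k: "1 \<le> k" using q by (simp add: k_def)
  define G G' where "G = Gamma (p + 1)" and "G' = Gamma (q + 1)"
  have G: "0 < G" "0 < G'" using q by (auto simp: G_def G'_def intro!: Gamma_real_pos)
  define D where "D = share_bound q * (r + r')"
  have D: "0 < D" using share_bound_pos[OF q(1)] r by (simp add: D_def)
  have side: "w * G * (r / (w * G')) powr k \<le> G * G' powr (- k) * D powr (k - 1) * r"
    if "0 < w" "0 < r" "r \<le> D * w" for w r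
  proof -
    have "(r / w) powr k = (r / w) * (r / w) powr (k - 1)"
      using that by (simp add: powr_diff)
    also have "\<dots> \<le> (r / w) * D powr (k - 1)"
      using that k by (intro mult_left_mono powr_mono2) (auto simp: field_simps)
    finally have "(G * G' powr (- k) * w) * (r / w) powr k \<le> (G * G' powr (- k) * w) * ((r / w) * D powr (k - 1))"
      using that G by (intro mult_left_mono) auto
    moreover have "(r / (w * G')) powr k = (r / w) powr k * G' powr (- k)"
      using that G by (simp add: powr_divide powr_mult powr_minus field_simps)
    ultimately show ?thesis using that by (simp add: ac_simps)
  qed
  have "w * G * (r / (w * G')) powr k + w' * G * (r' / (w' * G')) powr k
      \<le> G * G' powr (- k) * D powr (k - 1) * r + G * G' powr (- k) * D powr (k - 1) * r'"
    using w r share by (intro add_mono side) (auto simp: D_def ac_simps)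
  also have "\<dots> = (G * share_bound q powr (k - 1)) * G' powr (- k) * ((r + r') powr (k - 1) * (r + r'))"
  proof -
    have "D powr (k - 1) = share_bound q powr (k - 1) * (r + r') powr (k - 1)"
      using share_bound_pos[OF q(1)] r by (simp add: D_def powr_mult)
    then show ?thesis by (simp add: algebra_simps)
  qed
  also have "(r + r') powr (k - 1) * (r + r') = (r + r') powr k"
    using r by (simp add: powr_diff)
  also have "(G * share_bound q powr (k - 1)) * G' powr (- k) * (r + r') powr k
      \<le> ((p / q) powr p * G' powr k) * G' powr (- k) * (r + r') powr k"
    using Gamma_share_bound[OF q] by (intro mult_right_mono) (auto simp: G_def G'_def k_def)
  also have "\<dots> = (p / q) powr p * (r + r') powr k"
    using G by (simp add: powr_minus)
  finally show ?thesis by (simp add: G_def G'_def k_def)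
qed

lemma moment_norm_AE_0:
  assumes "AE \<omega> in M. X \<omega> = 0"
  shows "moment_norm M p X = 0"
proof -
  have "(\<integral>\<^sup>+ \<omega>. ennreal (\<bar>X \<omega>\<bar> powr p) \<partial>M) = 0"
    using assms by (intro nn_integral_zero') (auto elim!: eventually_mono)
  then show ?thesis by (simp add: moment_norm_def)
qed

lemma (in centered_log_concave) abs_moment_comparison:
  assumes q: "1 \<le> q" "q \<le> p"
  shows "moment_norm M p X \<le> ennreal (p / q) * moment_norm M q X"
proof -
  interpret R: centered_log_concave M "\<lambda>\<omega>. - X \<omega>" "\<lambda>x. V (- x)"
    by (rule reflected)
  \<comment> \<open>Mean zero enters here: both sides have the same first moment, which links their
    \<open>q\<close>-th moments.\<close>
  have pos_mean_eq: "R.pos_mean = pos_mean"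
  proof -
    have i: "integrable M (\<lambda>\<omega>. max (X \<omega>) 0)" "integrable M (\<lambda>\<omega>. max (- X \<omega>) 0)"
      using int_pos[of 0] R.int_pos[of 0] by simp_all
    have "pos_mean - R.pos_mean = expectation (\<lambda>\<omega>. max (X \<omega>) 0 - max (- X \<omega>) 0)"
      using i by (simp add: pos_mean_def R.pos_mean_def)
    also have "(\<lambda>\<omega>. max (X \<omega>) 0 - max (- X \<omega>) 0) = X" by auto
    finally show ?thesis using mean by simp
  qed
  have w: "tail 0 + R.tail 0 = 1"
  proof -
    \<comment> \<open>Both tails contain the event \<open>X = 0\<close>, so their sum is
      \<open>1\<close> only because that event is null.\<close>
    have "AE \<omega> in M. X \<omega> \<noteq> 0"
      using no_atom[of 0] prob_eq_0[of "{\<omega> \<in> space M. X \<omega> = 0}"] by (auto elim!: eventually_mono)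
    then have "tail 0 = prob {\<omega> \<in> space M. \<not> X \<omega> \<le> 0}"
      unfolding tail_def by (intro finite_measure_eq_AE) auto
    also have "\<dots> = 1 - prob {\<omega> \<in> space M. X \<omega> \<le> 0}"
      by (rule prob_neg) simp
    finally show ?thesis by (simp add: R.tail_def)
  qed
  define r r' where "r = (\<lambda>s. enn2real (pos_moment s))" and "r' = (\<lambda>s. enn2real (R.pos_moment s))"
  have N: "(\<integral>\<^sup>+ \<omega>. ennreal (\<bar>X \<omega>\<bar> powr s) \<partial>M) = ennreal (r s + r' s)" if "1 \<le> s" for s
  proof -
    have "(\<integral>\<^sup>+ \<omega>. ennreal (\<bar>X \<omega>\<bar> powr s) \<partial>M) = (\<integral>\<^sup>+ \<omega>. ennreal (max (X \<omega>) 0 powr s) + ennreal (max (- X \<omega>) 0 powr s) \<partial>M)"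
      by (intro nn_integral_cong) (auto simp: max_def)
    also have "\<dots> = pos_moment s + R.pos_moment s"
      unfolding pos_moment_def R.pos_moment_def by (rule nn_integral_add) auto
    also have "\<dots> = ennreal (r s + r' s)"
      using pos_moment_finite[OF that] R.pos_moment_finite[OF that] by (metis enn2real_nonneg ennreal_plus r_def r'_def)
    finally show ?thesis .
  qed
  have mn: "moment_norm M s X = ennreal ((r s + r' s) powr (1 / s))" if "1 \<le> s" for s
  proof -
    have "0 \<le> r s + r' s" by (simp add: r_def r'_def)
    then show ?thesis using N[OF that] by (simp add: moment_norm_def)
  qed
  have Tpos: "0 < tail 0" "0 < R.tail 0" by (rule tail_0_pos R.tail_0_pos)+
  have low: "tail 0 powr (1 - q) * pos_mean powr q \<le> r q" "R.tail 0 powr (1 - q) * pos_mean powr q \<le> r' q"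
    using pos_moment_lower[OF q(1)] R.pos_moment_lower[OF q(1)] by (auto simp: r_def r'_def pos_mean_eq)
  have G: "0 < Gamma (q + 1)" "0 < Gamma (p + 1)" using q by (auto intro!: Gamma_real_pos)
  have up: "r q \<le> Gamma (q + 1) * tail 0 powr (1 - q) * pos_mean powr q" "r' q \<le> Gamma (q + 1) * R.tail 0 powr (1 - q) * pos_mean powr q"
    using pos_moment_upper[OF q(1)] R.pos_moment_upper[OF q(1)] G by (auto simp: r_def r'_def pos_mean_eq intro!: enn2real_leI)
  have "0 < tail 0 powr (1 - q) * pos_mean powr q" "0 < R.tail 0 powr (1 - q) * pos_mean powr q"
    using Tpos pos_mean_pos by auto
  then have rpos: "0 < r q" "0 < r' q" using low by auto
  have p: "r p \<le> tail 0 * Gamma (p + 1) * (r q / (tail 0 * Gamma (q + 1))) powr (p / q)"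
    "r' p \<le> R.tail 0 * Gamma (p + 1) * (r' q / (R.tail 0 * Gamma (q + 1))) powr (p / q)"
    using pos_moment_comparison[of q p "r q"] R.pos_moment_comparison[of q p "r' q"] pos_moment_finite[OF q(1)] R.pos_moment_finite[OF q(1)] q G Tpos
    by (auto simp: r_def r'_def intro!: enn2real_leI)
  have "r q \<le> share_bound q * tail 0 * (r q + r' q)"
    using one_sided_share[OF q(1) tail_0_ge Tpos(2) w pos_mean_pos _ up(1) low(2)] rpos by simp
  moreover have "r' q \<le> share_bound q * R.tail 0 * (r' q + r q)"
    using one_sided_share[OF q(1) R.tail_0_ge Tpos(1) _ pos_mean_pos _ up(2) low(1)] w rpos by simp
  ultimately have "r p + r' p \<le> (p / q) powr p * (r q + r' q) powr (p / q)"
    using two_sided_bound[OF q Tpos rpos] p by (simp add: add.commute)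
  then have "(r p + r' p) powr (1 / p) \<le> ((p / q) powr p * (r q + r' q) powr (p / q)) powr (1 / p)"
    using q by (intro powr_mono2) (auto simp: r_def r'_def)
  also have "\<dots> = (p / q) * (r q + r' q) powr (1 / q)"
    using q rpos by (simp add: powr_mult powr_powr)
  finally have "ennreal ((r p + r' p) powr (1 / p)) \<le> ennreal ((p / q) * (r q + r' q) powr (1 / q))"
    by (rule ennreal_leI)
  also have "\<dots> = ennreal (p / q) * ennreal ((r q + r' q) powr (1 / q))"
    using q by (intro ennreal_mult) auto
  finally show ?thesis using mn[of p] mn[of q] q by simp
qed

theorem theorem1p2:
  fixes M :: "'a measure" and X :: "'a \<Rightarrow> real" and p q :: real
  assumes "prob_space M"
    and "X \<in> borel_measurable M"
    and "log_concave M X"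
    and "integrable M X" and "prob_space.expectation M X = 0"
    and "p \<ge> q" and "q \<ge> 1"
  shows "moment_norm M p X \<le> ennreal (p / q) * moment_norm M q X"
proof -
  interpret prob_space M by fact
  consider c where "AE \<omega> in M. X \<omega> = c"
    | V where "convex_ext V" "distributed M lborel X (\<lambda>x. exp_neg (V x))"
    using assms(3) unfolding log_concave_def by blast
  then show ?thesis
  proof cases
    case 1
    then have "expectation X = expectation (\<lambda>_. c)"
      using assms(2) by (intro integral_cong_AE) auto
    then have "c = 0" using assms(5) by (simp add: prob_space)
    then show ?thesis using 1 moment_norm_AE_0[of X M p] by simp
  next
    case 2
    then interpret centered_log_concave M X V
      by unfold_locales (use assms in auto)
    show ?thesis using assms by (intro abs_moment_comparison)
  qed
qed

end
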